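(* Let $G$ be a finite connected graph with root $r\in V(G)$, let $\mathcal{P}=\{F_1,\dots,F_t\}$ be a partition of $E(G)$, and let $g_1,\dots,g_t\in\mathbb{Z}_2^k$ be assigned to the classes. The labeling $$\lambda(v)=\sum_{e\in P(r,v)} g_{\mathrm{class}(e)}\in\mathbb{Z}_2^k,$$ where $P(r,v)$ is a path from $r$ to $v$, is well defined (independent of the chosen paths) if and only if for every cycle $C=(e_1,\dots,e_\ell)$ of $G$, $$\sum_{i=1}^{\ell} g_{\mathrm{class}(e_i)}=0\in\mathbb{Z}_2^k .$$ Moreover, it suffices to verify this last condition on the cycles of any cycle basis of $G$.
   Context: $\mathrm{class}(e)=j$ is the index with $e\in F_j$. A cycle basis of $G$ is a set of cycles whose edge sets form a basis over $\mathbb{F}_2$ of the cycle space of $G$. *)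

theory Defs
  imports
    "HOL-Library.Z2"
    "HOL-Library.Disjoint_Sets"
    "HOL-Library.Function_Algebras"
    "HOL-Library.Indicator_Function"
    "HOL-Analysis.Finite_Cartesian_Product"
begin

definition finite_graph :: "'a set \<Rightarrow> 'a set set \<Rightarrow> bool" where
  "finite_graph V E \<longleftrightarrow> finite V \<and> (\<forall>e\<in>E. e \<subseteq> V \<and> card e = 2)"

text \<open>Walks, paths and cycles are given by their vertex sequences. In a cycle
  the initial vertex is repeated at the end, so a cycle with
  \<open>l \<ge> 3\<close> edges is a list of length \<open>l + 1\<close>.\<close>

definition walk_edges :: "'a list \<Rightarrow> 'a set list" where
  "walk_edges p = map2 (\<lambda>x y. {x, y}) p (tl p)"

definition is_walk :: "'a set \<Rightarrow> 'a set set \<Rightarrow> 'a list \<Rightarrow> bool" where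
  "is_walk V E p \<longleftrightarrow> p \<noteq> [] \<and> set p \<subseteq> V \<and> set (walk_edges p) \<subseteq> E"

definition is_path :: "'a set \<Rightarrow> 'a set set \<Rightarrow> 'a \<Rightarrow> 'a list \<Rightarrow> 'a \<Rightarrow> bool" where
  "is_path V E u p v \<longleftrightarrow> is_walk V E p \<and> hd p = u \<and> last p = v \<and> distinct p"

definition is_cycle :: "'a set \<Rightarrow> 'a set set \<Rightarrow> 'a list \<Rightarrow> bool" where
  "is_cycle V E c \<longleftrightarrow> is_walk V E c \<and> hd c = last c \<and> distinct (tl c) \<and> length c \<ge> 4"

definition connected_graph :: "'a set \<Rightarrow> 'a set set \<Rightarrow> bool" where
  "connected_graph V E \<longleftrightarrow> V \<noteq> {} \<and> (\<forall>u\<in>V. \<forall>v\<in>V. \<exists>p. is_path V E u p v)"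

definition class_index :: "nat \<Rightarrow> (nat \<Rightarrow> 'a set set) \<Rightarrow> 'a set \<Rightarrow> nat" where
  "class_index t F e = (THE j. j \<in> {1..t} \<and> e \<in> F j)"

definition label_sum ::
  "nat \<Rightarrow> (nat \<Rightarrow> 'a set set) \<Rightarrow> (nat \<Rightarrow> bit ^ 'k) \<Rightarrow> 'a list \<Rightarrow> bit ^ 'k" where
  "label_sum t F g p = (\<Sum>e\<leftarrow>walk_edges p. g (class_index t F e))"

definition labeling_well_defined ::
  "'a set \<Rightarrow> 'a set set \<Rightarrow> 'a \<Rightarrow> nat \<Rightarrow> (nat \<Rightarrow> 'a set set) \<Rightarrow> (nat \<Rightarrow> bit ^ 'k) \<Rightarrow> bool" where
  "labeling_well_defined V E r t F g \<longleftrightarrow>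
     (\<forall>v\<in>V. \<forall>p q. is_path V E r p v \<longrightarrow> is_path V E r q v \<longrightarrow>
        label_sum t F g p = label_sum t F g q)"

text \<open>Sets of edges are identified with their characteristic functions, so that symmetric
  difference becomes addition in the vector space of functions into the field \<open>bit\<close>
  of two elements.\<close>

definition edge_scale :: "bit \<Rightarrow> ('a set \<Rightarrow> bit) \<Rightarrow> 'a set \<Rightarrow> bit" where
  "edge_scale c f = (\<lambda>e. c * f e)"

interpretation edge_space: vector_space "edge_scale :: bit \<Rightarrow> ('a set \<Rightarrow> bit) \<Rightarrow> _"
  by unfold_locales
    (simp_all add: edge_scale_def fun_eq_iff distrib_left distrib_right mult.assoc
      del: add_bit_eq_xor mult_bit_eq_and)

text \<open>The edge sets in which every vertex has even degree.\<close>

definition cycle_space :: "'a set \<Rightarrow> 'a set set \<Rightarrow> ('a set \<Rightarrow> bit) set" where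
  "cycle_space V E =
     {f. (\<forall>e. e \<notin> E \<longrightarrow> f e = 0) \<and> (\<forall>v\<in>V. (\<Sum>e | e \<in> E \<and> v \<in> e. f e) = 0)}"

lemma subspace_cycle_space: "edge_space.subspace (cycle_space V E)"
  by (auto simp: edge_space.subspace_def cycle_space_def edge_scale_def sum.distrib
      simp flip: sum_distrib_left simp del: add_bit_eq_xor mult_bit_eq_and)

definition edge_vector :: "'a list \<Rightarrow> 'a set \<Rightarrow> bit" where
  "edge_vector c = indicator (set (walk_edges c))"

text \<open>Injectivity excludes listing one cycle twice, by different vertex sequences.\<close>

definition is_cycle_basis :: "'a set \<Rightarrow> 'a set set \<Rightarrow> 'a list set \<Rightarrow> bool" where
  "is_cycle_basis V E B \<longleftrightarrow>
     (\<forall>c\<in>B. is_cycle V E c) \<and> inj_on edge_vector B \<and>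
     edge_space.independent (edge_vector ` B) \<and>
     edge_space.span (edge_vector ` B) = cycle_space V E"

end

theory Submission imports Defs "HOL-Library.Multiset" begin

text \<open>Two paths from \<open>r\<close> to \<open>v\<close> close up to a closed walk, which splits at repeated
  vertices into cycles and back-and-forth edges; the latter contribute \<open>0\<close> in characteristic
  two. Conversely, a cycle entered at the first vertex \<open>x\<close> met by a path from \<open>r\<close> gives two
  paths from \<open>r\<close> to a cycle neighbour \<open>y\<close> of \<open>x\<close>, and their labels differ by the label sum of
  the cycle. For the last part, the label sum of a cycle is the value of a linear map at its
  edge vector, which lies in the cycle space and hence in the span of the basis.\<close>

lemma vec_bit_add_self [simp]: "x + x = 0" for x :: "bit ^ 'k"
  by (simp add: vec_eq_iff del: add_bit_eq_xor)

lemma vec_bit_add_eq_0_iff: "x + y = 0 \<longleftrightarrow> x = y" for x y :: "bit ^ 'k"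
  by (metis add.right_neutral add.assoc vec_bit_add_self add.left_neutral)

section \<open>Edge lists of walks\<close>

lemma walk_edges_simps [simp]:
  "walk_edges [] = []"
  "walk_edges [x] = []"
  "walk_edges (x # y # p) = {x, y} # walk_edges (y # p)"
  by (simp_all add: walk_edges_def)

text \<open>The cut vertex \<open>x\<close> belongs to both pieces, so the edges on either side of
  it survive; cutting between two vertices would lose the edge joining them.\<close>

lemma walk_edges_append:
  "walk_edges (p @ x # q) = walk_edges (p @ [x]) @ walk_edges (x # q)"
proof (induction p)
  case (Cons a p)
  then show ?case by (cases p) auto
qed simp

lemma walk_edges_rev: "walk_edges (rev p) = rev (walk_edges p)"
proof (induction p rule: induct_list012)
  case (3 x y p)
  have "walk_edges (rev (x # y # p)) = walk_edges (rev (y # p)) @ walk_edges [y, x]"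
    using walk_edges_append[of "rev p" y "[x]"] by simp
  with 3 show ?case by (simp add: insert_commute)
qed simp_all

lemma walk_edges_subset: "e \<in> set (walk_edges p) \<Longrightarrow> e \<subseteq> set p"
  by (induction p rule: induct_list012) auto

text \<open>Both sides are the same closed walk with different starting points: each consists of the
  segments \<open>last b # a\<close> and \<open>last a # b\<close>, in opposite orders.\<close>

lemma mset_walk_edges_rotate:
  assumes "a \<noteq> []" "b \<noteq> []"
  shows "mset (walk_edges (last b # a @ b)) = mset (walk_edges (last a # b @ a))"
proof -
  obtain a' u b' v where [simp]: "a = a' @ [u]" "b = b' @ [v]"
    using assms by (metis append_butlast_last_id)
  show ?thesis
    using walk_edges_append[of "v # a'" u "b' @ [v]"]
      walk_edges_append[of "u # b'" v "a' @ [u]"] by simp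
qed

lemma distinct_walk_edges: "distinct p \<Longrightarrow> distinct (walk_edges p)"
  by (induction p rule: induct_list012) (auto dest: walk_edges_subset)

text \<open>The tail of \<open>c\<close> is a path, so only the closing edge could repeat. That edge
  contains \<open>x\<close>, whose only edge in the tail is \<open>{x, y}\<close>, and its other end
  differs from \<open>y\<close> because the cycle has at least three vertices.\<close>

lemma distinct_walk_edges_cycle:
  assumes "is_cycle V E c"
  shows "distinct (walk_edges c)"
proof -
  obtain x y z q where c: "c = last c # x # y # z # q" and d: "distinct (x # y # z # q)"
    using assms unfolding is_cycle_def
    by (cases c; cases "tl c"; cases "tl (tl c)"; cases "tl (tl (tl c))") auto
  let ?l = "last (z # q)"
  have "last c = ?l" by (subst c) simp
  then have c': "c = ?l # x # y # z # q" using c by simp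
  have l: "?l \<in> set (z # q)" by (rule last_in_set) simp
  have "{?l, x} \<noteq> {x, y}" using d l by (auto simp: doubleton_eq_iff simp del: last.simps)
  moreover have "{?l, x} \<notin> set (walk_edges (y # z # q))"
    using d walk_edges_subset[of "{?l, x}" "y # z # q"] by auto
  ultimately have "{?l, x} \<notin> set (walk_edges (x # y # z # q))" by simp
  moreover have "distinct (walk_edges (x # y # z # q))"
    using d by (rule distinct_walk_edges)
  ultimately show ?thesis by (subst c') (simp del: last.simps)
qed

lemma is_walk_append:
  "is_walk V E (p @ x # q) \<longleftrightarrow> is_walk V E (p @ [x]) \<and> is_walk V E (x # q)"
  unfolding is_walk_def by (subst walk_edges_append) auto

lemma is_walk_rev: "is_walk V E (rev p) \<longleftrightarrow> is_walk V E p"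
  by (simp add: is_walk_def walk_edges_rev)

text \<open>Rotates the cycle so that it starts at \<open>x\<close>. The multiset of edges is
  enough, since label sums do not depend on the order of the edges.\<close>

lemma cycle_from_vertex:
  assumes "is_cycle V E c" and "x \<in> set c"
  obtains d where "is_walk V E (x # d @ [x])"
    and "mset (walk_edges (x # d @ [x])) = mset (walk_edges c)"
    and "distinct (x # d)" and "set (x # d) = set c" and "d \<noteq> []"
proof -
  have c: "is_walk V E c" "hd c = last c" "distinct (tl c)" "length c \<ge> 4"
    using assms(1) by (auto simp: is_cycle_def)
  have ne: "tl c \<noteq> []" using c(4) by (cases c) auto
  have last: "last (tl c) = last c" using ne by (simp add: last_tl)
  have c_eq: "c = last (tl c) # tl c"
    using c(2) ne last by (metis list.collapse list.sel(2))
  have set_c: "set c = set (tl c)"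
    by (subst c_eq) (use ne in auto)
  obtain a b where ab: "tl c = a @ x # b"
    using assms(2) set_c by (metis split_list)
  have edges: "mset (walk_edges (x # (b @ a) @ [x])) = mset (walk_edges c)"
  \<comment> \<open>If \<open>b\<close> is empty, then \<open>x\<close> is already the repeated end
    vertex of \<open>c\<close> and no rotation takes place.\<close>
  proof (cases "b = []")
    case True
    then show ?thesis using c_eq ab by simp
  next
    case False
    then have "c = last b # (a @ [x]) @ b"
      by (subst c_eq) (simp add: ab)
    then show ?thesis using mset_walk_edges_rotate[of "a @ [x]" b] False by simp
  qed
  have vertices: "set (x # b @ a) = set c" using set_c ab by auto
  show thesis
  proof
    show "is_walk V E (x # (b @ a) @ [x])"
      using c(1) vertices mset_eq_setD[OF edges] by (auto simp: is_walk_def)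
    show "distinct (x # (b @ a))" using c(3) ab by auto
    have "length (tl c) \<ge> 3" using c(4) by simp
    then show "b @ a \<noteq> []" using ab by auto
  qed (use edges vertices in auto)
qed

section \<open>Independence of paths\<close>

lemma label_sum_append:
  "label_sum t F g (p @ x # q) = label_sum t F g (p @ [x]) + label_sum t F g (x # q)"
  unfolding label_sum_def by (subst walk_edges_append) simp

lemma label_sum_rev: "label_sum t F g (rev p) = label_sum t F g p"
  unfolding label_sum_def walk_edges_rev
  by (simp add: rev_map flip: sum_mset_sum_list)

lemma label_sum_mset_cong:
  assumes "mset (walk_edges p) = mset (walk_edges q)"
  shows "label_sum t F g p = label_sum t F g q"
  unfolding label_sum_def by (simp add: assms flip: sum_mset_sum_list)

lemma label_sum_closed_walk:
  assumes "finite_graph V E"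
    and cycles: "\<And>c. is_cycle V E c \<Longrightarrow> label_sum t F g c = 0"
    and "is_walk V E p" "hd p = last p"
  shows "label_sum t F g p = 0"
  using assms(3,4)
proof (induction "length p" arbitrary: p rule: less_induct)
  case less
  obtain x p' where p: "p = x # p'" using less.prems by (cases p) (auto simp: is_walk_def)
  show ?case
  proof (cases "distinct p'")
    case True
    \<comment> \<open>The closed walks too short to be cycles: a single vertex, a loop, which edges
      of cardinality 2 exclude, and one edge traversed back and forth, whose label cancels.\<close>
    consider "p' = []" | y where "p' = [y]" | y z where "p' = [y, z]" | "length p \<ge> 4"
      using p by (cases p' rule: remdups_adj.cases; cases "tl (tl p')") auto
    then show ?thesis
    proof cases
      case 2
      then have "{x} \<in> E" using less.prems p by (simp add: is_walk_def)
      then show ?thesis using assms(1) by (auto simp: finite_graph_def)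
    next
      case 4
      then show ?thesis using cycles less.prems True p by (auto simp: is_cycle_def)
    qed (use less.prems p in \<open>auto simp: label_sum_def insert_commute\<close>)
  next
    case False
    then obtain a b c y where p': "p' = a @ [y] @ b @ [y] @ c"
      by (metis not_distinct_decomp)
    have p1: "p = (x # a) @ y # (b @ y # c)" using p p' by simp
    have walks: "is_walk V E ((x # a) @ [y])" "is_walk V E ((y # b) @ [y])" "is_walk V E (y # c)"
      using less.prems(1) p1 is_walk_append[of V E "x # a" y "b @ y # c"]
        is_walk_append[of V E "y # b" y c] by auto
    \<comment> \<open>Cutting out the closed piece between two occurrences of \<open>y\<close>
      leaves two closed walks. The inner one is shorter than \<open>p\<close> because it misses the
      starting \<open>x\<close>, the outer one because it misses \<open>b\<close> and one
      \<open>y\<close>.\<close>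
    have inner: "label_sum t F g ((y # b) @ [y]) = 0"
      using walks p1 by (intro less.hyps) auto
    have outer: "label_sum t F g ((x # a) @ y # c) = 0"
    proof (rule less.hyps)
      show "is_walk V E ((x # a) @ y # c)" using walks by (subst is_walk_append) simp
      show "hd ((x # a) @ y # c) = last ((x # a) @ y # c)"
        using less.prems(2) p1 by auto
    qed (use p1 in simp)
    have "label_sum t F g p =
        label_sum t F g ((x # a) @ [y]) + label_sum t F g ((y # b) @ [y]) + label_sum t F g (y # c)"
      using p1 label_sum_append[of t F g "x # a" y "b @ y # c"]
        label_sum_append[of t F g "y # b" y c] by (simp add: add.assoc)
    also have "\<dots> = label_sum t F g ((x # a) @ y # c)"
      by (subst label_sum_append) (simp only: inner add_0_right)
    finally show ?thesis using outer by simp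
  qed
qed

lemma labeling_well_definedI:
  assumes "finite_graph V E"
    and "\<And>c. is_cycle V E c \<Longrightarrow> label_sum t F g c = 0"
  shows "labeling_well_defined V E r t F g"
  unfolding labeling_well_defined_def
proof (intro ballI allI impI)
  fix v p q assume p: "is_path V E r p v" and q: "is_path V E r q v"
  obtain p' where p': "p = p' @ [v]"
    using p by (metis append_butlast_last_id is_path_def is_walk_def)
  obtain q' where q': "q = q' @ [v]"
    using q by (metis append_butlast_last_id is_path_def is_walk_def)
  have rev_q: "rev q = v # rev q'" using q' by simp
  have "label_sum t F g (p' @ v # rev q') = 0"
  proof (rule label_sum_closed_walk[OF assms])
    show "is_walk V E (p' @ v # rev q')"
      using p q p' rev_q is_walk_rev[of V E q] is_walk_append[of V E p' v "rev q'"]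
      by (simp add: is_path_def)
    have "last (p' @ v # rev q') = hd q" using rev_q
      by (metis last_appendR last_rev list.distinct(1))
    moreover have "hd (p' @ v # rev q') = hd p" using p' by (cases p') auto
    ultimately show "hd (p' @ v # rev q') = last (p' @ v # rev q')"
      using p q by (simp add: is_path_def)
  qed
  then have "label_sum t F g p + label_sum t F g (rev q) = 0"
    using p' rev_q by (simp add: label_sum_append[of t F g p' v "rev q'"])
  then show "label_sum t F g p = label_sum t F g q"
    by (simp add: label_sum_rev vec_bit_add_eq_0_iff)
qed

lemma label_sum_cycle_eq_0:
  assumes conn: "connected_graph V E" and r: "r \<in> V"
    and wd: "labeling_well_defined V E r t F g" and c: "is_cycle V E c"
  shows "label_sum t F g c = 0"
proof -
  have c_ne: "c \<noteq> []" and c_V: "set c \<subseteq> V" using c by (auto simp: is_cycle_def is_walk_def)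
  then have "hd c \<in> V" by auto
  then obtain p where p: "is_path V E r p (hd c)"
    using conn r by (auto simp: connected_graph_def)
  then have "\<exists>x\<in>set p. x \<in> set c"
    using c_ne by (metis hd_in_set is_path_def is_walk_def last_in_set)
  \<comment> \<open>Taking the first common vertex keeps \<open>a\<close> off the cycle, so
    \<open>a\<close> can be continued along the cycle in either direction without repeating a
    vertex.\<close>
  then obtain a x b where ab: "p = a @ x # b" and x: "x \<in> set c" and a: "\<forall>z\<in>set a. z \<notin> set c"
    by (rule split_list_first_propE)
  obtain d where d: "is_walk V E (x # d @ [x])"
      "mset (walk_edges (x # d @ [x])) = mset (walk_edges c)"
      "distinct (x # d)" "set (x # d) = set c" "d \<noteq> []"
    using cycle_from_vertex[OF c x] .
  \<comment> \<open>\<open>y\<close> is the last vertex before the cycle returns to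
    \<open>x\<close>: it is reached from \<open>x\<close> the long way through \<open>d'\<close> or
    by the single closing edge.\<close>
  obtain d' y where d': "d = d' @ [y]" using d(5) by (metis append_butlast_last_id)
  have a_walk: "is_walk V E (a @ [x])" and a_dist: "distinct a"
    using p ab is_walk_append[of V E a x b] by (auto simp: is_path_def)
  have a_hd: "hd (a @ x # q) = r" for q using p ab by (cases a) (auto simp: is_path_def)
  have walks: "is_walk V E (x # d' @ [y])" "is_walk V E [y, x]"
    using d(1) d' is_walk_append[of V E "x # d'" y "[x]"] by auto
  have y: "y \<in> set c" "y \<in> V" using d(4) d' c_V by auto
  have "is_path V E r (a @ x # d' @ [y]) y"
    unfolding is_path_def
  proof (intro conjI)
    show "is_walk V E (a @ x # d' @ [y])"
      using a_walk walks(1) by (subst is_walk_append) simp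
    show "distinct (a @ x # d' @ [y])" using a a_dist d(3,4) d' by auto
  qed (use a_hd in auto)
  moreover have "is_path V E r (a @ [x, y]) y"
    unfolding is_path_def
  proof (intro conjI)
    have "is_walk V E [x, y]" using walks(2) is_walk_rev[of V E "[y, x]"] by simp
    then show "is_walk V E (a @ [x, y])" using a_walk by (subst is_walk_append) simp
    show "distinct (a @ [x, y])" using a a_dist d(3,4) d' y x by auto
  qed (use a_hd in auto)
  ultimately have "label_sum t F g (a @ x # d' @ [y]) = label_sum t F g (a @ [x, y])"
    using wd y(2) unfolding labeling_well_defined_def by blast
  \<comment> \<open>The common initial part from \<open>r\<close> to \<open>x\<close>
    cancels.\<close>
  then have "label_sum t F g (x # d' @ [y]) = label_sum t F g [x, y]"
    using label_sum_append[of t F g a x "d' @ [y]"] label_sum_append[of t F g a x "[y]"] by simp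
  also have "\<dots> = label_sum t F g [y, x]"
    using label_sum_rev[of t F g "[y, x]"] by simp
  finally have "label_sum t F g (x # d @ [x]) = 0"
    using label_sum_append[of t F g "x # d'" y "[x]"] d' by simp
  then show ?thesis using label_sum_mset_cong[OF d(2)] by metis
qed

section \<open>Reduction to a cycle basis\<close>

text \<open>A telescoping sum: each interior position of the walk is counted by the two edges next
  to it and cancels modulo 2. On a closed walk the two end terms cancel as well.\<close>

lemma sum_list_walk_edges_endpoints:
  fixes h :: "'a \<Rightarrow> bit"
  assumes "\<And>e. e \<in> set (walk_edges p) \<Longrightarrow> card e = 2" and "p \<noteq> []"
  shows "(\<Sum>e\<leftarrow>walk_edges p. \<Sum>x\<in>e. h x) = h (hd p) + h (last p)"
  using assms
proof (induction p rule: induct_list012)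
  case (3 x y p)
  have "x \<noteq> y" using 3(3)[of "{x, y}"] by auto
  moreover have "(\<Sum>e\<leftarrow>walk_edges (y # p). \<Sum>x\<in>e. h x) = h y + h (last (y # p))"
    using 3 by simp
  moreover have "h x + h y + (h y + z) = h x + z" for z
    by (cases "h y") (auto simp: algebra_simps)
  ultimately show ?case by (simp del: add_bit_eq_xor last.simps add: last_ConsR)
qed simp_all

lemma edge_vector_in_cycle_space:
  assumes "finite_graph V E" and "is_cycle V E c"
  shows "edge_vector c \<in> cycle_space V E"
proof -
  have c: "is_walk V E c" "hd c = last c" "c \<noteq> []" "set (walk_edges c) \<subseteq> E"
    using assms(2) by (auto simp: is_cycle_def is_walk_def)
  have fin: "finite E"
    using assms(1) by (auto simp: finite_graph_def intro: finite_subset[of E "Pow V"])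
  have card: "card e = 2" if "e \<in> set (walk_edges c)" for e
    using that c(4) assms(1) by (auto simp: finite_graph_def)
  have "(\<Sum>e | e \<in> E \<and> v \<in> e. edge_vector c e) = 0" for v
  proof -
    have "(\<Sum>e | e \<in> E \<and> v \<in> e. edge_vector c e) =
        (\<Sum>e\<in>set (walk_edges c). of_bool (v \<in> e))"
      unfolding edge_vector_def
      by (rule sum.mono_neutral_cong) (use fin c(4) in \<open>auto simp: indicator_def\<close>)
    \<comment> \<open>No edge of a cycle repeats, so the sum over the edge set is a sum along the
      walk.\<close>
    also have "\<dots> = (\<Sum>e\<leftarrow>walk_edges c. of_bool (v \<in> e))"
      using distinct_walk_edges_cycle[OF assms(2)] by (simp add: sum_list_distinct_conv_sum_set)
    \<comment> \<open>This puts the degree of \<open>v\<close> into telescoping form, with the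
      indicator of \<open>v\<close> as the vertex function \<open>h\<close>.\<close>
    also have "\<dots> = (\<Sum>e\<leftarrow>walk_edges c. \<Sum>x\<in>e. of_bool (x = v))"
    proof (intro arg_cong[where f = sum_list] map_cong refl)
      fix e assume "e \<in> set (walk_edges c)"
      then have "finite e" using card by (metis card.infinite zero_neq_numeral)
      then show "of_bool (v \<in> e) = (\<Sum>x\<in>e. of_bool (x = v))"
        by (simp add: of_bool_def)
    qed
    also have "\<dots> = 0"
      using sum_list_walk_edges_endpoints[OF card c(3)] c(2) by simp
    finally show ?thesis .
  qed
  then show ?thesis using c(4) by (auto simp: cycle_space_def edge_vector_def indicator_def)
qed

text \<open>The linear extension of the edge weights \<open>w\<close> to characteristic functions,
  so that vanishing label sums become membership in a kernel.\<close>

definition edge_functional :: "'a set set \<Rightarrow> ('a set \<Rightarrow> bit ^ 'k) \<Rightarrow> ('a set \<Rightarrow> bit) \<Rightarrow> bit ^ 'k" where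
  "edge_functional E w f = (\<Sum>e\<in>E. f e *s w e)"

lemma subspace_edge_functional_kernel: "edge_space.subspace {f. edge_functional E w f = 0}"
proof (rule edge_space.subspaceI)
  show "0 \<in> {f. edge_functional E w f = 0}"
    by (simp add: edge_functional_def)
next
  have "edge_functional E w (f + f') = edge_functional E w f + edge_functional E w f'" for f f'
    by (simp only: edge_functional_def plus_fun_apply vector_sadd_rdistrib sum.distrib)
  then show "f + f' \<in> {f. edge_functional E w f = 0}"
    if "f \<in> {f. edge_functional E w f = 0}" "f' \<in> {f. edge_functional E w f = 0}" for f f'
    using that by simp
next
  have "edge_functional E w (edge_scale c f) = c *s edge_functional E w f" for c f
    by (simp add: edge_functional_def edge_scale_def vec_eq_iff sum_distrib_left mult.assoc
        del: mult_bit_eq_and)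
  then show "edge_scale c f \<in> {f. edge_functional E w f = 0}"
    if "f \<in> {f. edge_functional E w f = 0}" for c f
    using that by simp
qed

text \<open>The edge vector records only which edges occur; as a cycle uses each edge once, nothing
  is lost against the sum along the walk.\<close>

lemma edge_functional_edge_vector:
  assumes "finite_graph V E" and "is_cycle V E c"
  shows "edge_functional E (\<lambda>e. g (class_index t F e)) (edge_vector c) = label_sum t F g c"
proof -
  have "finite E"
    using assms(1) by (auto simp: finite_graph_def intro: finite_subset[of E "Pow V"])
  moreover have "set (walk_edges c) \<subseteq> E"
    using assms(2) by (auto simp: is_cycle_def is_walk_def)
  ultimately have "edge_functional E (\<lambda>e. g (class_index t F e)) (edge_vector c) =
      (\<Sum>e\<in>set (walk_edges c). g (class_index t F e))"
    unfolding edge_functional_def edge_vector_def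
    by (intro sum.mono_neutral_cong_right) auto
  then show ?thesis
    unfolding label_sum_def
    using distinct_walk_edges_cycle[OF assms(2)] by (simp add: sum_list_distinct_conv_sum_set)
qed

lemma label_sum_cycle_basis:
  assumes "finite_graph V E" and "is_cycle_basis V E B"
    and "\<forall>c\<in>B. label_sum t F g c = 0" and "is_cycle V E c"
  shows "label_sum t F g c = 0"
proof -
  let ?K = "{f. edge_functional E (\<lambda>e. g (class_index t F e)) f = 0}"
  have "edge_vector ` B \<subseteq> ?K"
  proof (rule image_subsetI)
    fix b assume "b \<in> B"
    then show "edge_vector b \<in> ?K"
      using assms(2,3) edge_functional_edge_vector[OF assms(1), of b g t F]
      by (simp add: is_cycle_basis_def)
  qed
  \<comment> \<open>The kernel is a subspace containing the generators, hence all of their span,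
    which is the cycle space.\<close>
  then have "edge_space.span (edge_vector ` B) \<subseteq> ?K"
    by (rule edge_space.span_minimal) (rule subspace_edge_functional_kernel)
  then have "edge_vector c \<in> ?K"
    using edge_vector_in_cycle_space[OF assms(1,4)] assms(2) by (auto simp: is_cycle_basis_def)
  then show ?thesis using edge_functional_edge_vector[OF assms(1,4), of g t F] by simp
qed

theorem theorem3:
  fixes V :: "'a set" and E :: "'a set set" and r :: 'a
    and t :: nat and F :: "nat \<Rightarrow> 'a set set" and g :: "nat \<Rightarrow> bit ^ 'k"
  assumes "finite_graph V E" and "connected_graph V E" and "r \<in> V"
    and "inj_on F {1..t}" and "partition_on E (F ` {1..t})"
  shows "(labeling_well_defined V E r t F g \<longleftrightarrow>
            (\<forall>C. is_cycle V E C \<longrightarrow> label_sum t F g C = 0)) \<and>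
         (\<forall>B. is_cycle_basis V E B \<longrightarrow> (\<forall>C\<in>B. label_sum t F g C = 0) \<longrightarrow>
            (\<forall>C. is_cycle V E C \<longrightarrow> label_sum t F g C = 0))"
  using labeling_well_definedI[OF assms(1)] label_sum_cycle_eq_0[OF assms(2,3)]
    label_sum_cycle_basis[OF assms(1)]
  by blast

end
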